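(* Let $f:\{0,1\}^n\times\{0,1\}^n\to\{0,1\}$ be a Boolean function. If $f$ is injective for Bob or $f$ is injective for Alice, then $$GH(f)\,\log(GH(f))\ \ge\ n.$$
   Context: Logarithms are base 2. $f$ is injective for Alice if for every two different $x,x'\in\{0,1\}^n$ there exists $y$ with $f(x,y)\ne f(x',y)$. $f$ is injective for Bob if for every two different $y,y'\in\{0,1\}^n$ there exists $x$ with $f(x,y)\neq f(x,y')$. Garden-hose game of size $s\in\mathbb{N}$: let $A=\{1^A,\dots,s^A\}$, $B=\{1^B,\dots,s^B\}$, $A_\circ=A\cup\{0\}$, and $E=\{\{i^A,i^B\}:1\le i\le s\}$ (the pipes). A game $G$ is given by functions $E_{A_\circ},E_B$ on $\{0,1\}^n$, where $E_{A_\circ}(x)$ is a set of edges (no self-loops) on $A_\circ$ and $E_B(y)$ is a set of edges (no self-loops) on $B$, such that the graphs $(A_\circ,E_{A_\circ}(x))$ and $(B,E_B(y))$ have maximum degree at most $1$. Put $G(x,y)=(A_\circ\cup B,\,E\cup E_{A_\circ}(x)\cup E_B(y))$. There is a unique maximal path $\pi(x,y)$ in $G(x,y)$ starting at $0$ (it consists of $0$ alone if $0$ has degree $0$). $G$ computes $f$ if for all $x,y$ the endpoint of $\pi(x,y)$ lies in $A_\circ$ when $f(x,y)=0$ and in $B$ when $f(x,y)=1$. $GH(f)$, the garden-hose complexity of $f$, is the smallest size $s$ of a game computing $f$.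
   Formalization: For n = 1 it is additionally assumed that f is injective for Bob, because the claim fails otherwise: f(x,y)=x with n=1 is injective for Alice and has GH(f)=1, so GH(f) log GH(f)=0<1; the only excluded functions are f=x and f=1-x, for which the claim is false. *)

theory Defs
  imports Complex_Main
begin

text \<open>
  The cube of dimension \<open>n\<close> is the set of Boolean lists of length \<open>n\<close>, with \<open>True\<close> for 1. A Boolean
  function on pairs is a total function on lists of which only the values on the cube matter.
\<close>

definition cube :: "nat \<Rightarrow> bool list set" where
  "cube n = {x. length x = n}"

definition injective_for_Alice :: "nat \<Rightarrow> (bool list \<Rightarrow> bool list \<Rightarrow> bool) \<Rightarrow> bool" where
  "injective_for_Alice n f \<longleftrightarrow>
     (\<forall>x\<in>cube n. \<forall>x'\<in>cube n. x \<noteq> x' \<longrightarrow> (\<exists>y\<in>cube n. f x y \<noteq> f x' y))"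

definition injective_for_Bob :: "nat \<Rightarrow> (bool list \<Rightarrow> bool list \<Rightarrow> bool) \<Rightarrow> bool" where
  "injective_for_Bob n f \<longleftrightarrow>
     (\<forall>y\<in>cube n. \<forall>y'\<in>cube n. y \<noteq> y' \<longrightarrow> (\<exists>x\<in>cube n. f x y \<noteq> f x y'))"

datatype vertex = Tap | AEnd nat | BEnd nat

text \<open>\<open>Tap\<close> is the vertex 0; \<open>AEnd i\<close> and \<open>BEnd i\<close> are the two ends of the \<open>i\<close>-th pipe.\<close>

definition A0_side :: "nat \<Rightarrow> vertex set" where
  "A0_side s = insert Tap (AEnd ` {1..s})"

definition B_side :: "nat \<Rightarrow> vertex set" where
  "B_side s = BEnd ` {1..s}"

definition pipes :: "nat \<Rightarrow> vertex set set" where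
  "pipes s = {{AEnd i, BEnd i} | i. i \<in> {1..s}}"

definition simple_edges :: "vertex set \<Rightarrow> vertex set set" where
  "simple_edges V = {{u, v} | u v. u \<in> V \<and> v \<in> V \<and> u \<noteq> v}"

definition vertex_degree :: "vertex set set \<Rightarrow> vertex \<Rightarrow> nat" where
  "vertex_degree E v = card {e \<in> E. v \<in> e}"

definition max_degree_le_1 :: "vertex set \<Rightarrow> vertex set set \<Rightarrow> bool" where
  "max_degree_le_1 V E \<longleftrightarrow> E \<subseteq> simple_edges V \<and> (\<forall>v\<in>V. vertex_degree E v \<le> 1)"

definition is_game :: "nat \<Rightarrow> nat \<Rightarrow> (bool list \<Rightarrow> vertex set set) \<Rightarrow> (bool list \<Rightarrow> vertex set set) \<Rightarrow> bool" where
  "is_game n s EA EB \<longleftrightarrow>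
     (\<forall>x\<in>cube n. max_degree_le_1 (A0_side s) (EA x)) \<and>
     (\<forall>y\<in>cube n. max_degree_le_1 (B_side s) (EB y))"

definition game_edges ::
  "nat \<Rightarrow> (bool list \<Rightarrow> vertex set set) \<Rightarrow> (bool list \<Rightarrow> vertex set set) \<Rightarrow> bool list \<Rightarrow> bool list \<Rightarrow> vertex set set" where
  "game_edges s EA EB x y = pipes s \<union> EA x \<union> EB y"

definition path_from :: "vertex set \<Rightarrow> vertex set set \<Rightarrow> vertex \<Rightarrow> vertex list \<Rightarrow> bool" where
  "path_from V E u p \<longleftrightarrow>
     p \<noteq> [] \<and> hd p = u \<and> set p \<subseteq> V \<and> distinct p \<and> successively (\<lambda>v w. {v, w} \<in> E) p"

definition maximal_path_from :: "vertex set \<Rightarrow> vertex set set \<Rightarrow> vertex \<Rightarrow> vertex list \<Rightarrow> bool" where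
  "maximal_path_from V E u p \<longleftrightarrow> path_from V E u p \<and> (\<nexists>v. path_from V E u (p @ [v]))"

text \<open>
  The description below is proper for every game: the tap has degree at most 1 and every other
  vertex has degree at most 2, so there is exactly one maximal path that starts at the tap.
\<close>

definition water_path ::
  "nat \<Rightarrow> (bool list \<Rightarrow> vertex set set) \<Rightarrow> (bool list \<Rightarrow> vertex set set) \<Rightarrow> bool list \<Rightarrow> bool list \<Rightarrow> vertex list" where
  "water_path s EA EB x y =
     (THE p. maximal_path_from (A0_side s \<union> B_side s) (game_edges s EA EB x y) Tap p)"

definition computes ::
  "nat \<Rightarrow> nat \<Rightarrow> (bool list \<Rightarrow> vertex set set) \<Rightarrow> (bool list \<Rightarrow> vertex set set)
    \<Rightarrow> (bool list \<Rightarrow> bool list \<Rightarrow> bool) \<Rightarrow> bool" where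
  "computes n s EA EB f \<longleftrightarrow>
     (\<forall>x\<in>cube n. \<forall>y\<in>cube n.
        (\<not> f x y \<longrightarrow> last (water_path s EA EB x y) \<in> A0_side s) \<and>
        (f x y \<longrightarrow> last (water_path s EA EB x y) \<in> B_side s))"

text \<open>
  The minimum is attained, since every function is computed by a game of size \<open>2 ^ (n + 1)\<close>: Alice
  joins the tap to a pipe that encodes \<open>x\<close>, and Bob joins the end of that pipe to a private return
  pipe if and only if the value of \<open>f\<close> is 0.
\<close>

definition GH :: "nat \<Rightarrow> (bool list \<Rightarrow> bool list \<Rightarrow> bool) \<Rightarrow> nat" where
  "GH n f = (LEAST s. \<exists>EA EB. is_game n s EA EB \<and> computes n s EA EB f)"

end

theory Submission
  imports Defs "HOL-Library.FuncSet"
begin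

text \<open>
  An injective player must use a different matching for every input, so \<open>2 ^ n\<close> is at most the
  number of matchings on that player's vertices. A matching is an involution on its vertex set.
  Bob has \<open>s\<close> vertices, hence at most \<open>s ^ s\<close> matchings. Alice has \<open>s + 1\<close> vertices, but for
  \<open>s \<ge> 2\<close> she too has at most \<open>s ^ s\<close> matchings: drop the tap, and redirect the vertex matched
  with it, if any, to some other vertex. That vertex is then the only one not fixed by the square
  of the resulting self-map, so the matching can be recovered.
\<close>

section \<open>Matchings as involutions\<close>

text \<open>Unmatched vertices become fixed points, so a matching turns into a total involution. The
  \<open>THE\<close> is meaningful only under the degree bound, which the facts on
  \<open>mate\<close> below therefore assume.\<close>

definition mate :: "vertex set set \<Rightarrow> vertex \<Rightarrow> vertex" where
  "mate E v = (if \<exists>w. {v, w} \<in> E then THE w. {v, w} \<in> E else v)"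

lemma simple_edgesD:
  assumes "{v, w} \<in> simple_edges V"
  shows "v \<in> V" "w \<in> V" "v \<noteq> w"
  using assms unfolding simple_edges_def by (auto simp: doubleton_eq_iff)

lemma finite_simple_edges: "finite V \<Longrightarrow> finite (simple_edges V)"
  by (rule finite_subset[of _ "Pow V"]) (auto simp: simple_edges_def)

text \<open>Both edges lie in the set of edges at \<open>v\<close>, whose cardinality is at most 1.
  Finiteness of \<open>V\<close> is used because \<open>card\<close> is 0 on infinite sets.\<close>

lemma matching_unique:
  assumes "max_degree_le_1 V E" "finite V" "{v, w} \<in> E" "{v, w'} \<in> E"
  shows "w = w'"
proof -
  have E: "E \<subseteq> simple_edges V" using assms(1) by (simp add: max_degree_le_1_def)
  then have "v \<in> V" "finite E"
    using assms simple_edgesD finite_simple_edges finite_subset by blast+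
  then have "card {e \<in> E. v \<in> e} \<le> Suc 0" "finite {e \<in> E. v \<in> e}"
    using assms(1) by (auto simp: max_degree_le_1_def vertex_degree_def)
  then have "{v, w} = {v, w'}"
    using assms(3,4) by (simp add: card_le_Suc0_iff_eq)
  then show ?thesis by (auto simp: doubleton_eq_iff)
qed

lemma mate_eq:
  assumes "max_degree_le_1 V E" "finite V" "{v, w} \<in> E"
  shows "mate E v = w"
proof -
  have "(THE w. {v, w} \<in> E) = w"
    using assms(3) by (rule the_equality) (rule matching_unique[OF assms(1,2) _ assms(3)])
  then show ?thesis using assms(3) unfolding mate_def by auto
qed

lemma mate_edge:
  assumes "mate E v \<noteq> v" "max_degree_le_1 V E" "finite V"
  shows "{v, mate E v} \<in> E"
proof -
  obtain w where "{v, w} \<in> E" using assms(1) unfolding mate_def by presburger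
  then show ?thesis using mate_eq[OF assms(2,3)] by simp
qed

lemma mate_in:
  assumes "max_degree_le_1 V E" "finite V" "v \<in> V"
  shows "mate E v \<in> V"
proof (cases "mate E v = v")
  case False
  then have "{v, mate E v} \<in> simple_edges V"
    using mate_edge assms unfolding max_degree_le_1_def by blast
  then show ?thesis by (rule simple_edgesD)
qed (use assms in simp)

lemma mate_mate:
  assumes "max_degree_le_1 V E" "finite V"
  shows "mate E (mate E v) = v"
proof (cases "mate E v = v")
  case False
  then have "{mate E v, v} \<in> E"
    using mate_edge assms by (metis insert_commute)
  then show ?thesis by (rule mate_eq[OF assms])
qed simp

lemma matching_eqI:
  assumes "max_degree_le_1 V E" "max_degree_le_1 V E'" "finite V"
    and "\<And>v. v \<in> V \<Longrightarrow> mate E v = mate E' v"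
  shows "E = E'"
proof -
  \<comment> \<open>Stated for an arbitrary pair, so that it yields both inclusions.\<close>
  have "E \<subseteq> E'"
    if E: "max_degree_le_1 V E" and E': "max_degree_le_1 V E'"
      and eq: "\<And>v. v \<in> V \<Longrightarrow> mate E v = mate E' v" for E E'
  proof
    fix e assume "e \<in> E"
    moreover have "E \<subseteq> simple_edges V" using E by (simp add: max_degree_le_1_def)
    ultimately obtain v w where e: "e = {v, w}" "v \<in> V" "v \<noteq> w"
      unfolding simple_edges_def by auto
    then have "mate E' v = w" using mate_eq[OF E assms(3)] eq \<open>e \<in> E\<close> by metis
    then show "e \<in> E'" using mate_edge[OF _ E' assms(3), of v] e by auto
  qed
  then show ?thesis using assms by (metis subset_antisym)
qed

section \<open>Counting matchings\<close>

lemma finite_matchings: "finite V \<Longrightarrow> finite {E. max_degree_le_1 V E}"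
  by (rule finite_subset[of _ "Pow (simple_edges V)"])
    (auto simp: max_degree_le_1_def finite_simple_edges)

lemma card_matchings_le:
  assumes "finite V"
  shows "card {E. max_degree_le_1 V E} \<le> card V ^ card V"
proof -
  have "card {E. max_degree_le_1 V E} \<le> card (V \<rightarrow>\<^sub>E V)"
  proof (rule card_inj_on_le)
    show "inj_on (\<lambda>E. restrict (mate E) V) {E. max_degree_le_1 V E}"
    proof (rule inj_onI, clarify)
      fix E E' assume E: "max_degree_le_1 V E" "max_degree_le_1 V E'"
        and eq: "restrict (mate E) V = restrict (mate E') V"
      show "E = E'" by (rule matching_eqI[OF E assms]) (metis eq restrict_apply')
    qed
    show "(\<lambda>E. restrict (mate E) V) ` {E. max_degree_le_1 V E} \<subseteq> V \<rightarrow>\<^sub>E V"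
      using mate_in assms by auto
  qed (simp add: assms finite_PiE)
  then show ?thesis by (simp add: card_PiE assms)
qed

text \<open>If an involution moves \<open>a\<close>, the partner of \<open>a\<close> lies elsewhere
  and points back to \<open>a\<close>, so the values off \<open>a\<close> determine the value at
  \<open>a\<close>.\<close>

lemma matching_eqI_except:
  assumes E: "max_degree_le_1 V E" and E': "max_degree_le_1 V E'" and V: "finite V"
    and eq: "\<And>v. v \<in> V - {a} \<Longrightarrow> mate E v = mate E' v"
  shows "E = E'"
proof (rule matching_eqI[OF E E' V])
  have *: "mate E' a = mate E a"
    if "max_degree_le_1 V E" "max_degree_le_1 V E'" "mate E a \<noteq> a" "a \<in> V"
      "\<And>v. v \<in> V - {a} \<Longrightarrow> mate E v = mate E' v" for E E'
  proof -
    have "mate E a \<in> V - {a}" using mate_in[OF that(1) V that(4)] that(3) by simp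
    then have "mate E' (mate E a) = a" using that(5) mate_mate[OF that(1) V] by metis
    then show ?thesis using mate_mate[OF that(2) V] by metis
  qed
  fix v assume "v \<in> V"
  show "mate E v = mate E' v"
  proof (cases "v = a")
    case True
    then show ?thesis using *[OF E E'] *[OF E' E] eq \<open>v \<in> V\<close> by metis
  qed (use eq \<open>v \<in> V\<close> in simp)
qed

text \<open>Here \<open>a\<close> stands for the tap. For a singleton \<open>V\<close> the bound
  fails: there are two matchings, but \<open>1 ^ 1\<close> is 1.\<close>

lemma card_matchings_insert_le:
  assumes V: "finite V" and a: "a \<notin> V" and card: "card V \<ge> 2"
  shows "card {E. max_degree_le_1 (insert a V) E} \<le> card V ^ card V"
proof -
  have "\<exists>w. w \<in> V \<and> w \<noteq> v" for v
  proof (rule ccontr)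
    assume "\<not> ?thesis"
    then have "V \<subseteq> {v}" by blast
    then have "card V \<le> card {v}" by (intro card_mono) auto
    then show False using card by simp
  qed
  then obtain k where k: "\<And>v. k v \<in> V" "\<And>v. k v \<noteq> v" by metis
  let ?W = "insert a V"
  have W: "finite ?W" using V by simp
  define g where "g E v = (if mate E v = a then k v else mate E v)" for E v
  have g_in: "g E v \<in> V" if "max_degree_le_1 ?W E" "v \<in> V" for E v
    using mate_in[OF that(1) W] that k by (auto simp: g_def)
  \<comment> \<open>On \<open>V\<close>, \<open>g E\<close> differs from the involution only at the
    partner of \<open>a\<close>, and exactly there \<open>g E (g E v)\<close> differs from
    \<open>v\<close>.\<close>
  have decode: "mate E v = (if g E (g E v) = v then g E v else a)"
    if E: "max_degree_le_1 ?W E" and "v \<in> V" for E v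
  proof -
    have "v \<noteq> a" using that a by auto
    note mm = mate_mate[OF E W]
    show ?thesis
    proof (cases "mate E v = a")
      case True
      \<comment> \<open>As \<open>v\<close> and \<open>a\<close> are matched with each other,
        \<open>k v\<close> is matched with neither; hence \<open>g E\<close> agrees with
        \<open>mate E\<close> at \<open>k v\<close> and does not lead back to
        \<open>v\<close>.\<close>
      have "mate E (k v) \<noteq> v" using mm True k a by metis
      moreover have "mate E (k v) \<noteq> a" using mm True k by metis
      ultimately show ?thesis using True by (simp add: g_def)
    next
      case False
      then show ?thesis using mm \<open>v \<noteq> a\<close> by (simp add: g_def)
    qed
  qed
  have "card {E. max_degree_le_1 ?W E} \<le> card (V \<rightarrow>\<^sub>E V)"
  proof (rule card_inj_on_le)
    show "inj_on (\<lambda>E. restrict (g E) V) {E. max_degree_le_1 ?W E}"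
    proof (rule inj_onI, clarify)
      fix E E' assume E: "max_degree_le_1 ?W E" "max_degree_le_1 ?W E'"
        and eq: "restrict (g E) V = restrict (g E') V"
      have "g E v = g E' v" if "v \<in> V" for v using eq that by (metis restrict_apply')
      then have "mate E v = mate E' v" if "v \<in> V" for v
        using decode[OF E(1) that] decode[OF E(2) that] g_in[OF E(1) that] that by simp
      then show "E = E'" by (intro matching_eqI_except[OF E W, of a]) simp
    qed
    show "(\<lambda>E. restrict (g E) V) ` {E. max_degree_le_1 ?W E} \<subseteq> V \<rightarrow>\<^sub>E V"
      using g_in by auto
  qed (simp add: V finite_PiE)
  then show ?thesis by (simp add: card_PiE V)
qed

section \<open>Water paths and a game for every function\<close>

lemma card_cube: "card (cube n) = 2 ^ n" and finite_cube: "finite (cube n)"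
  using card_lists_length_eq[of "UNIV :: bool set" n] finite_lists_length_eq[of "UNIV :: bool set" n]
  by (simp_all add: cube_def)

lemma A0_B_disjoint: "A0_side s \<inter> B_side s = {}"
  by (auto simp: A0_side_def B_side_def)

text \<open>By \<open>step\<close>, any path that leaves a prefix of \<open>p\<close> must follow
  \<open>p\<close>, so all paths from \<open>u\<close> are prefixes of \<open>p\<close>, and only
  \<open>p\<close> itself is maximal.\<close>

lemma maximal_path_unique:
  assumes p: "maximal_path_from V E u p"
    and step: "\<And>k v. \<lbrakk>k < length p; path_from V E u (take (Suc k) p @ [v])\<rbrakk>
      \<Longrightarrow> Suc k < length p \<and> v = p ! Suc k"
  shows "(THE q. maximal_path_from V E u q) = p"
proof (rule the_equality)
  show "maximal_path_from V E u p" by (rule p)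
  have pre: "\<exists>k < length p. q = take (Suc k) p" if "path_from V E u q" for q
    using that
  proof (induction q rule: rev_induct)
    case Nil
    then show ?case by (simp add: path_from_def)
  next
    case (snoc v q)
    have p0: "p \<noteq> []" "hd p = u" using p by (auto simp: maximal_path_from_def path_from_def)
    show ?case
    proof (cases "q = []")
      case True
      then have "v = u" using snoc.prems by (simp add: path_from_def)
      then show ?thesis using True p0 by (cases p) auto
    next
      case False
      then have "path_from V E u q"
        using snoc.prems by (auto simp: path_from_def successively_append_iff)
      then obtain k where k: "k < length p" "q = take (Suc k) p" using snoc.IH by blast
      then have "Suc k < length p \<and> v = p ! Suc k" using step snoc.prems by blast
      then show ?thesis using k by (intro exI[of _ "Suc k"]) (simp add: take_Suc_conv_app_nth)
    qed
  qed
  fix q assume q: "maximal_path_from V E u q"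
  then obtain k where k: "k < length p" "q = take (Suc k) p"
    using pre unfolding maximal_path_from_def by blast
  \<comment> \<open>A proper prefix could be extended by the next vertex of
    \<open>p\<close>.\<close>
  have "\<not> Suc k < length p"
  proof
    assume less: "Suc k < length p"
    have "path_from V E u p" using p by (simp add: maximal_path_from_def)
    moreover have "p = take (Suc (Suc k)) p @ drop (Suc (Suc k)) p" by simp
    ultimately have "path_from V E u (take (Suc (Suc k)) p)"
      using less unfolding path_from_def
      by (metis (no_types, lifting) distinct_take hd_take set_take_subset subset_trans
          successively_append_iff take_eq_Nil zero_less_Suc nat.distinct(1))
    then have "path_from V E u (q @ [p ! Suc k])"
      using k less by (simp add: take_Suc_conv_app_nth)
    then show False using q by (auto simp: maximal_path_from_def)
  qed
  then show "q = p" using k by simp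
qed

text \<open>Guarantees that the \<open>LEAST\<close> in \<open>GH\<close> is attained. Pipe
  \<open>e x\<close> encodes \<open>x\<close>, and pipe \<open>e x + N\<close> is its private return
  pipe.\<close>

lemma game_exists: "\<exists>s EA EB. is_game n s EA EB \<and> computes n s EA EB f"
proof -
  define N where "N = card (cube n)"
  obtain c where "bij_betw c (cube n) {0..<N}"
    using ex_bij_betw_finite_nat[OF finite_cube] N_def by blast
  \<comment> \<open>The successor is taken because pipes are numbered from 1.\<close>
  define e where "e x = Suc (c x)" for x
  have e: "e x \<in> {1..N}" if "x \<in> cube n" for x
    using bij_betwE[OF \<open>bij_betw c _ _\<close>] that by (fastforce simp: e_def)
  have inj: "e x = e x' \<longleftrightarrow> x = x'" if "x \<in> cube n" "x' \<in> cube n" for x x'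
    using \<open>bij_betw c _ _\<close> that by (auto simp: e_def bij_betw_def inj_on_def)
  let ?s = "N + N"
  define EA where "EA x = {{Tap, AEnd (e x)}}" for x
  define EB where "EB y = {{BEnd (e x), BEnd (e x + N)} | x. x \<in> cube n \<and> \<not> f x y}" for y
  have le1: "card S \<le> Suc 0" if "\<And>a b. a \<in> S \<Longrightarrow> b \<in> S \<Longrightarrow> a = b" for S :: "vertex set set"
    using that by (cases "finite S") (auto simp: card_le_Suc0_iff_eq)
  have "is_game n ?s EA EB"
    unfolding is_game_def max_degree_le_1_def vertex_degree_def
  proof (intro conjI ballI)
    fix x assume "x \<in> cube n"
    then show "EA x \<subseteq> simple_edges (A0_side ?s)"
      using e[of x] unfolding EA_def simple_edges_def A0_side_def by fastforce
    show "card {e \<in> EA x. v \<in> e} \<le> 1" for v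
      by (simp, rule le1) (auto simp: EA_def)
  next
    fix y
    have "{BEnd (e x), BEnd (e x + N)} \<in> simple_edges (B_side ?s)" if "x \<in> cube n" for x
      using e[OF that] unfolding simple_edges_def B_side_def
      by (intro CollectI exI[of _ "BEnd (e x)"] exI[of _ "BEnd (e x + N)"]) auto
    then show "EB y \<subseteq> simple_edges (B_side ?s)"
      unfolding EB_def by blast
    \<comment> \<open>Encoding pipes have indices at most \<open>N\<close> and return pipes larger
      ones, so a shared end determines the input through the injectivity of
      \<open>e\<close>.\<close>
    have "x = x'" if "x \<in> cube n" "x' \<in> cube n"
      "v \<in> {BEnd (e x), BEnd (e x + N)}" "v \<in> {BEnd (e x'), BEnd (e x' + N)}" for v x x'
      using that e[OF that(1)] e[OF that(2)] inj[OF that(1,2)] by auto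
    then show "card {e \<in> EB y. v \<in> e} \<le> 1" for v
      by (simp, intro le1) (unfold EB_def, blast)
  qed
  moreover have "computes n ?s EA EB f"
    unfolding computes_def
  proof (intro ballI)
    fix x y assume x: "x \<in> cube n" and y: "y \<in> cube n"
    let ?V = "A0_side ?s \<union> B_side ?s" and ?G = "game_edges ?s EA EB x y"
    have Tap: "{Tap, w} \<in> ?G \<longleftrightarrow> w = AEnd (e x)" for w
      using e[OF x] by (auto simp: game_edges_def pipes_def EA_def EB_def doubleton_eq_iff)
    have A: "{AEnd i, w} \<in> ?G \<longleftrightarrow> (i \<in> {1..?s} \<and> w = BEnd i) \<or> (i = e x \<and> w = Tap)" for i w
      by (auto simp: game_edges_def pipes_def EA_def EB_def doubleton_eq_iff)
    have B: "{BEnd i, w} \<in> ?G \<longleftrightarrow> (i \<in> {1..?s} \<and> w = AEnd i) \<or>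
        (\<exists>x'\<in>cube n. \<not> f x' y \<and> (i = e x' \<and> w = BEnd (e x' + N) \<or> i = e x' + N \<and> w = BEnd (e x')))"
      for i w
      by (auto simp: game_edges_def pipes_def EA_def EB_def doubleton_eq_iff)
    have B1: "{BEnd (e x), w} \<in> ?G \<longleftrightarrow> w = AEnd (e x) \<or> \<not> f x y \<and> w = BEnd (e x + N)" for w
      using e e[OF x] inj x unfolding B by fastforce
    have B2: "{BEnd (e x + N), w} \<in> ?G \<longleftrightarrow> w = AEnd (e x + N) \<or> \<not> f x y \<and> w = BEnd (e x)" for w
      using e e[OF x] inj x unfolding B by fastforce
    have A1: "{AEnd (e x), w} \<in> ?G \<longleftrightarrow> w = BEnd (e x) \<or> w = Tap" for w
      using e[OF x] unfolding A by auto
    have A2: "{AEnd (e x + N), w} \<in> ?G \<longleftrightarrow> w = BEnd (e x + N)" for w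
      using e[OF x] unfolding A by auto
    have V: "Tap \<in> ?V" "AEnd (e x) \<in> ?V" "BEnd (e x) \<in> ?V" "AEnd (e x + N) \<in> ?V" "BEnd (e x + N) \<in> ?V"
      using e[OF x] by (auto simp: A0_side_def B_side_def)
    have N: "N > 0" using e[OF x] by auto
    show "(\<not> f x y \<longrightarrow> last (water_path ?s EA EB x y) \<in> A0_side ?s) \<and>
        (f x y \<longrightarrow> last (water_path ?s EA EB x y) \<in> B_side ?s)"
    proof (cases "f x y")
      case True
      \<comment> \<open>Bob leaves the end of pipe \<open>e x\<close> open, and the water stops on
        his side.\<close>
      let ?p = "[Tap, AEnd (e x), BEnd (e x)]"
      have "water_path ?s EA EB x y = ?p"
        unfolding water_path_def
      proof (rule maximal_path_unique)
        show "maximal_path_from ?V ?G Tap ?p"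
          using V True by (auto simp: maximal_path_from_def path_from_def Tap A1 B1)
        show "Suc k < length ?p \<and> v = ?p ! Suc k"
          if "k < length ?p" "path_from ?V ?G Tap (take (Suc k) ?p @ [v])" for k v
          using that True
          by (auto simp: path_from_def less_Suc_eq Tap A1 B1)
      qed
      then show ?thesis using True e[OF x] by (auto simp: B_side_def)
    next
      case False
      \<comment> \<open>Bob's link sends the water back through the return pipe to Alice.\<close>
      let ?p = "[Tap, AEnd (e x), BEnd (e x), BEnd (e x + N), AEnd (e x + N)]"
      have "water_path ?s EA EB x y = ?p"
        unfolding water_path_def
      proof (rule maximal_path_unique)
        show "maximal_path_from ?V ?G Tap ?p"
          using V False N by (auto simp: maximal_path_from_def path_from_def Tap A1 A2 B1 B2)
        show "Suc k < length ?p \<and> v = ?p ! Suc k"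
          if "k < length ?p" "path_from ?V ?G Tap (take (Suc k) ?p @ [v])" for k v
          using that False
          by (auto simp: path_from_def less_Suc_eq Tap A1 A2 B1 B2)
      qed
      then show ?thesis using False e[OF x] by (auto simp: A0_side_def)
    qed
  qed
  ultimately show ?thesis by blast
qed

section \<open>From injectivity to the bound\<close>

text \<open>The water path depends on the inputs only through the two matchings, and the
  disjointness of the sides makes its endpoint determine the value.\<close>

lemma computes_cong:
  assumes "computes n s EA EB f" "x \<in> cube n" "x' \<in> cube n" "y \<in> cube n" "y' \<in> cube n"
    and "EA x = EA x'" "EB y = EB y'"
  shows "f x y = f x' y'"
proof -
  have "water_path s EA EB x y = water_path s EA EB x' y'"
    by (simp add: water_path_def game_edges_def assms(6,7))
  then show ?thesis using assms(1-5) A0_B_disjoint[of s] unfolding computes_def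
    by (metis disjoint_iff)
qed

lemma Alice_matchings_distinct:
  assumes "computes n s EA EB f" "injective_for_Alice n f"
  shows "inj_on EA (cube n)"
  using computes_cong[OF assms(1)] assms(2) unfolding injective_for_Alice_def inj_on_def by metis

lemma Bob_matchings_distinct:
  assumes "computes n s EA EB f" "injective_for_Bob n f"
  shows "inj_on EB (cube n)"
  using computes_cong[OF assms(1)] assms(2) unfolding injective_for_Bob_def inj_on_def by metis

lemma Bob_bound:
  assumes "is_game n s EA EB" "computes n s EA EB f" "injective_for_Bob n f"
  shows "2 ^ n \<le> s ^ s"
proof -
  have "card (cube n) \<le> card {E. max_degree_le_1 (B_side s) E}"
    by (rule card_inj_on_le[OF Bob_matchings_distinct[OF assms(2,3)]])
      (use assms(1) in \<open>auto simp: is_game_def finite_matchings B_side_def\<close>)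
  also have "\<dots> \<le> card (B_side s) ^ card (B_side s)"
    by (rule card_matchings_le) (simp add: B_side_def)
  also have "card (B_side s) = s" by (simp add: B_side_def card_image inj_on_def)
  finally show ?thesis by (simp add: card_cube)
qed

text \<open>The assumption \<open>n \<ge> 2\<close> serves to force two pipes, as the count without
  the tap requires.\<close>

lemma Alice_bound:
  assumes "is_game n s EA EB" "computes n s EA EB f" "injective_for_Alice n f" "n \<ge> 2"
  shows "2 ^ n \<le> s ^ s"
proof -
  have le: "card (cube n) \<le> card {E. max_degree_le_1 (A0_side s) E}"
    by (rule card_inj_on_le[OF Alice_matchings_distinct[OF assms(2,3)]])
      (use assms(1) in \<open>auto simp: is_game_def finite_matchings A0_side_def\<close>)
  have card: "card (AEnd ` {1..s}) = s" by (simp add: card_image inj_on_def)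
  have "s \<ge> 2"
  proof (rule ccontr)
    assume "\<not> s \<ge> 2"
    then have "{1..s} \<subseteq> {1}" by auto
    \<comment> \<open>With at most one pipe there is only one possible edge, hence at most two
      matchings for at least four inputs.\<close>
    then have "A0_side s \<subseteq> {Tap, AEnd 1}" unfolding A0_side_def by blast
    then have "simple_edges (A0_side s) \<subseteq> {{Tap, AEnd 1}}" unfolding simple_edges_def by blast
    then have "{E. max_degree_le_1 (A0_side s) E} \<subseteq> Pow {{Tap, AEnd 1}}"
      unfolding max_degree_le_1_def by blast
    then have "card {E. max_degree_le_1 (A0_side s) E} \<le> card (Pow {{Tap, AEnd 1}})"
      by (intro card_mono) auto
    then have "(2::nat) ^ n \<le> 2" using le by (simp add: card_cube card_Pow)
    moreover have "(2::nat) ^ 2 \<le> 2 ^ n" using assms(4) by (intro power_increasing) auto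
    ultimately show False by simp
  qed
  then have "card {E. max_degree_le_1 (A0_side s) E} \<le> s ^ s"
    using card_matchings_insert_le[of "AEnd ` {1..s}" Tap] card unfolding A0_side_def by auto
  then show ?thesis using le by (simp add: card_cube)
qed

text \<open>The case \<open>n = 1\<close> needs care: the function that returns Alice's bit is
  injective for Alice and has a game with one pipe, so its left-hand side is 0.\<close>

theorem proposition4p10:
  fixes n :: nat and f :: "bool list \<Rightarrow> bool list \<Rightarrow> bool"
  assumes "injective_for_Bob n f \<or> injective_for_Alice n f"
    and "n = 1 \<Longrightarrow> injective_for_Bob n f"
  shows "real (GH n f) * log 2 (real (GH n f)) \<ge> real n"
proof -
  let ?s = "GH n f"
  obtain EA EB where game: "is_game n ?s EA EB" "computes n ?s EA EB f"
    using LeastI_ex[OF game_exists[of n f]] unfolding GH_def by blast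
  show ?thesis
  proof (cases "n = 0")
    case True
    then show ?thesis by (cases "?s = 0") auto
  next
    case False
    have le: "2 ^ n \<le> ?s ^ ?s"
    proof (cases "injective_for_Bob n f")
      case True
      then show ?thesis using Bob_bound game by blast
    next
      case not_Bob: False
      then have "n \<ge> 2" using assms(2) False by (cases "n = 1") auto
      then show ?thesis using Alice_bound game assms(1) not_Bob by blast
    qed
    have "(2::nat) ^ 1 \<le> 2 ^ n" using False by (intro power_increasing) auto
    \<comment> \<open>Since \<open>0 ^ 0 = 1\<close>, the value 0 is excluded only because
      \<open>2 ^ n\<close> is at least 2.\<close>
    then have pos: "?s > 0" using le by (cases "?s = 0") auto
    have "real n = log 2 (2 ^ n)" by simp
    also have "\<dots> \<le> log 2 (real ?s ^ ?s)"
      using le pos by (subst log_le_cancel_iff) (auto simp flip: of_nat_power)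
    also have "\<dots> = real ?s * log 2 (real ?s)" using pos by (simp add: log_nat_power)
    finally show ?thesis .
  qed
qed

end
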